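(* Let $q,n$ be integers with $q\ge 2$, $n\ge 2$, and suppose $q-1$ divides $qn-1$. Then $\mathsf{id}_{(qn-1)/(q-1)}\le\mathsf{PHP}^{qn}_{n}$ if and only if there exists an $\mathrm{RBIBD}(qn,q,1)$.
   Context: A number $N\ge1$ is identified with $\{0,\dots,N-1\}$. A (finite) problem $\mathsf{P}$ consists of a nonempty finite set of instances and, for each instance $x$, a nonempty finite set $\mathsf{P}(x)$ of solutions. For finite problems $\mathsf{P},\mathsf{Q}$, write $\mathsf{P}\le\mathsf{Q}$ if there exist a map $\Phi$ sending each $\mathsf{P}$-instance $x$ to a $\mathsf{Q}$-instance $\Phi(x)$ and a (partial) map $\Psi$ on $\mathsf{Q}$-solutions such that for every $\mathsf{P}$-instance $x$ and every $y\in\mathsf{Q}(\Phi(x))$, $\Psi(y)\in\mathsf{P}(x)$. For integers $m>n\ge2$, the problem $\mathsf{PHP}^m_n$ has as instances all functions $f:m\to n$, and the solutions to $f$ are all unordered pairs $\{i,j\}\subseteq m$ with $i\ne j$ and $f(i)=f(j)$. For $k\ge1$, the problem $\mathsf{id}_k$ has instances $j\in\{1,\dots,k\}$, each instance $j$ having unique solution $j$. A $\mathrm{BIBD}(p,n,\lambda)$ is a finite set $V$ of $p$ points together with a collection of $n$-element subsets of $V$ (blocks) such that every pair of distinct points lies in exactly $\lambda$ blocks; an $\mathrm{RBIBD}(p,n,\lambda)$ is a $\mathrm{BIBD}(p,n,\lambda)$ whose blocks can be partitioned into parallel classes such that each point lies in exactly one block of each parallel class. *)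

theory Defs
  imports Main "HOL-Library.FuncSet" "HOL-Library.Multiset"
begin

record ('a, 'b) problem =
  instances :: "'a set"
  solutions :: "'a \<Rightarrow> 'b set"

definition finite_problem :: "('a, 'b) problem \<Rightarrow> bool" where
  "finite_problem P \<longleftrightarrow>
     finite (instances P) \<and> instances P \<noteq> {} \<and>
     (\<forall>x\<in>instances P. finite (solutions P x) \<and> solutions P x \<noteq> {})"

definition all_solutions :: "('a, 'b) problem \<Rightarrow> 'b set" where
  "all_solutions P = (\<Union>x\<in>instances P. solutions P x)"

definition problem_le :: "('a, 'b) problem \<Rightarrow> ('c, 'd) problem \<Rightarrow> bool"
    (infix \<open>\<le>\<^sub>P\<close> 50) where
  "P \<le>\<^sub>P Q \<longleftrightarrow>
     (\<exists>\<Phi> \<Psi>. \<Phi> ` instances P \<subseteq> instances Q \<and> dom \<Psi> \<subseteq> all_solutions Q \<and>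
        (\<forall>x\<in>instances P. \<forall>y\<in>solutions Q (\<Phi> x). \<exists>z\<in>solutions P x. \<Psi> y = Some z))"

definition PHP :: "nat \<Rightarrow> nat \<Rightarrow> (nat \<Rightarrow> nat, nat set) problem" where
  "PHP m n =
     \<lparr>instances = {..<m} \<rightarrow>\<^sub>E {..<n},
      solutions = (\<lambda>f. {{i, j} | i j. i < m \<and> j < m \<and> i \<noteq> j \<and> f i = f j})\<rparr>"

definition id_problem :: "nat \<Rightarrow> (nat, nat) problem" where
  "id_problem k = \<lparr>instances = {1..k}, solutions = (\<lambda>j. {j})\<rparr>"

lemma finite_problem_PHP:
  assumes "m > n" and "n \<ge> 2"
  shows "finite_problem (PHP m n)"
proof -
  have "finite (solutions (PHP m n) f)" for f
    by (rule finite_subset[of _ "Pow {..<m}"]) (auto simp: PHP_def)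
  moreover have "solutions (PHP m n) f \<noteq> {}" if "f \<in> instances (PHP m n)" for f
  proof -
    have "f ` {..<m} \<subseteq> {..<n}"
      using that by (auto simp: PHP_def)
    then have "card (f ` {..<m}) \<le> n"
      by (metis card_lessThan card_mono finite_lessThan)
    then have "\<not> inj_on f {..<m}"
      using assms(1) by (auto dest: card_image)
    then show ?thesis
      by (auto simp: PHP_def inj_on_def)
  qed
  moreover have "finite (instances (PHP m n))"
    by (simp add: PHP_def finite_PiE)
  moreover have "instances (PHP m n) \<noteq> {}"
    using assms by (auto simp: PHP_def PiE_eq_empty_iff lessThan_empty_iff)
  ultimately show ?thesis
    by (simp add: finite_problem_def)
qed

lemma finite_problem_id_problem:
  "k \<ge> 1 \<Longrightarrow> finite_problem (id_problem k)"
  by (simp add: finite_problem_def id_problem_def)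

text \<open>
  Blocks form a multiset, so repeated blocks are allowed, as is usual for
  \<open>\<lambda> > 1\<close>. For \<open>\<lambda> = 1\<close> and block size at least 2 no block can repeat.
\<close>

definition BIBD :: "'a set \<Rightarrow> 'a set multiset \<Rightarrow> nat \<Rightarrow> nat \<Rightarrow> nat \<Rightarrow> bool" where
  "BIBD V \<B> p n l \<longleftrightarrow>
     finite V \<and> card V = p \<and>
     (\<forall>b\<in>#\<B>. b \<subseteq> V \<and> card b = n) \<and>
     (\<forall>x\<in>V. \<forall>y\<in>V. x \<noteq> y \<longrightarrow> size {#b \<in># \<B>. x \<in> b \<and> y \<in> b#} = l)"

definition parallel_class :: "'a set \<Rightarrow> 'a set multiset \<Rightarrow> bool" where
  "parallel_class V \<C> \<longleftrightarrow> (\<forall>x\<in>V. size {#b \<in># \<C>. x \<in> b#} = 1)"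

text \<open>A partition of the multiset of blocks is a multiset of multisets with union \<open>\<B>\<close>.\<close>

definition RBIBD :: "'a set \<Rightarrow> 'a set multiset \<Rightarrow> nat \<Rightarrow> nat \<Rightarrow> nat \<Rightarrow> bool" where
  "RBIBD V \<B> p n l \<longleftrightarrow>
     BIBD V \<B> p n l \<and>
     (\<exists>R. \<Sum>\<^sub># R = \<B> \<and> (\<forall>\<C>\<in>#R. parallel_class V \<C>))"

end

theory Submission
  imports Defs "HOL-Library.Disjoint_Sets" "HOL-Library.Ramsey"
begin

text \<open>
  A reduction of \<open>id\<^sub>k\<close> to \<open>PHP\<close> amounts to \<open>k\<close> colourings of \<open>q n\<close> points with \<open>n\<close> colours whose
  sets of monochromatic pairs are disjoint. If a colouring has classes of sizes \<open>s\<^sub>c\<close>, twice the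
  number of its monochromatic pairs is \<open>q n (q - 1) + \<Sum>\<^sub>c (s\<^sub>c - q)\<^sup>2\<close>. Since \<open>k (q - 1) = q n - 1\<close>,
  disjointness leaves no slack: all classes have size \<open>q\<close> and every pair is monochromatic for exactly
  one colouring, so the colourings are the parallel classes of an RBIBD. Conversely, the parallel
  classes of an RBIBD are colourings with these properties, and the same count shows that there
  are \<open>k\<close> of them.
\<close>

section \<open>Reductions of identity problems\<close>

lemma disjoint_family_on_iff_unique_index:
  "disjoint_family_on A I \<longleftrightarrow> (\<forall>i\<in>I. \<forall>j\<in>I. \<forall>x. x \<in> A i \<and> x \<in> A j \<longrightarrow> i = j)"
  unfolding disjoint_family_on_def by blast

lemma disjoint_family_on_iff_card_index:
  "disjoint_family_on A I \<longleftrightarrow> (\<forall>x\<in>(\<Union>i\<in>I. A i). card {i \<in> I. x \<in> A i} = 1)"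
proof -
  have "card {i \<in> I. x \<in> A i} = 1 \<longleftrightarrow> (\<forall>i\<in>I. \<forall>j\<in>I. x \<in> A i \<and> x \<in> A j \<longrightarrow> i = j)"
    if "x \<in> (\<Union>i\<in>I. A i)" for x
    using that by (simp add: card_1_singleton_iff set_eq_iff) metis
  then show ?thesis
    unfolding disjoint_family_on_iff_unique_index by blast
qed

lemma id_problem_le_iff:
  "id_problem k \<le>\<^sub>P Q \<longleftrightarrow>
     (\<exists>\<Phi>. \<Phi> ` {1..k} \<subseteq> instances Q \<and> disjoint_family_on (\<lambda>j. solutions Q (\<Phi> j)) {1..k})"
proof
  assume "id_problem k \<le>\<^sub>P Q"
  then obtain \<Phi> \<Psi> where "\<Phi> ` {1..k} \<subseteq> instances Q"
    and \<Psi>: "\<forall>j\<in>{1..k}. \<forall>y\<in>solutions Q (\<Phi> j). \<Psi> y = Some j"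
    by (auto simp: problem_le_def id_problem_def)
  moreover have "disjoint_family_on (\<lambda>j. solutions Q (\<Phi> j)) {1..k}"
    unfolding disjoint_family_on_iff_unique_index by (metis \<Psi> option.inject)
  ultimately show "\<exists>\<Phi>. \<Phi> ` {1..k} \<subseteq> instances Q \<and>
      disjoint_family_on (\<lambda>j. solutions Q (\<Phi> j)) {1..k}"
    by blast
next
  assume "\<exists>\<Phi>. \<Phi> ` {1..k} \<subseteq> instances Q \<and>
      disjoint_family_on (\<lambda>j. solutions Q (\<Phi> j)) {1..k}"
  then obtain \<Phi> where inst: "\<Phi> ` {1..k} \<subseteq> instances Q"
    and disj: "disjoint_family_on (\<lambda>j. solutions Q (\<Phi> j)) {1..k}"
    by blast
  define solves where "solves j y \<longleftrightarrow> j \<in> {1..k} \<and> y \<in> solutions Q (\<Phi> j)" for j y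
  define \<Psi> where "\<Psi> y = (if \<exists>j. solves j y then Some (THE j. solves j y) else None)" for y
  have solves_unique: "i = j" if "solves i y" "solves j y" for i j y
    using disj that unfolding disjoint_family_on_iff_unique_index solves_def by blast
  have "\<Psi> y = Some j" if "solves j y" for j y
    using that solves_unique the_equality[of "\<lambda>j. solves j y" j] by (metis \<Psi>_def)
  moreover have "dom \<Psi> \<subseteq> all_solutions Q"
    using inst by (fastforce simp: \<Psi>_def solves_def all_solutions_def split: if_splits)
  ultimately show "id_problem k \<le>\<^sub>P Q"
    unfolding problem_le_def
    by (intro exI[of _ \<Phi>] exI[of _ \<Psi>]) (use inst in \<open>auto simp: id_problem_def solves_def\<close>)
qed

section \<open>Colourings with disjoint sets of monochromatic pairs\<close>

definition monochromatic_pairs :: "'a set \<Rightarrow> ('a \<Rightarrow> 'c) \<Rightarrow> 'a set set" where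
  "monochromatic_pairs V f = {{a, b} | a b. a \<in> V \<and> b \<in> V \<and> a \<noteq> b \<and> f a = f b}"

definition disjoint_colourings :: "'a set \<Rightarrow> 'c set \<Rightarrow> 'j set \<Rightarrow> ('j \<Rightarrow> 'a \<Rightarrow> 'c) \<Rightarrow> bool" where
  "disjoint_colourings V C J f \<longleftrightarrow>
     (\<forall>j\<in>J. f j \<in> V \<rightarrow> C) \<and> disjoint_family_on (\<lambda>j. monochromatic_pairs V (f j)) J"

lemma doubleton_in_monochromatic_pairs_iff [simp]:
  "{a, b} \<in> monochromatic_pairs V f \<longleftrightarrow> a \<in> V \<and> b \<in> V \<and> a \<noteq> b \<and> f a = f b"
  by (auto simp: monochromatic_pairs_def doubleton_eq_iff)

lemma monochromatic_pairs_subset_nsets: "monochromatic_pairs V f \<subseteq> [V]\<^bsup>2\<^esup>"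
  by (auto simp: monochromatic_pairs_def)

lemma monochromatic_pairs_restrict: "monochromatic_pairs V (restrict f V) = monochromatic_pairs V f"
  by (auto simp: monochromatic_pairs_def)

lemma image_in_monochromatic_pairs:
  assumes "e \<in> monochromatic_pairs U (f \<circ> h)" and "inj_on h U" and "h \<in> U \<rightarrow> V"
  shows "h ` e \<in> monochromatic_pairs V f"
proof -
  obtain a b where "e = {a, b}" "a \<in> U" "b \<in> U" "a \<noteq> b" "f (h a) = f (h b)"
    using assms(1) by (auto simp: monochromatic_pairs_def)
  then show ?thesis
    using assms(2,3) by (auto simp: inj_on_eq_iff)
qed

lemma disjoint_colourings_comp:
  assumes "disjoint_colourings V C J f" and "inj_on h U" and "h \<in> U \<rightarrow> V"
  shows "disjoint_colourings U C J (\<lambda>j. f j \<circ> h)"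
proof -
  have "disjoint_family_on (\<lambda>j. monochromatic_pairs U (f j \<circ> h)) J"
    using assms(1) image_in_monochromatic_pairs[OF _ assms(2,3)]
    unfolding disjoint_colourings_def disjoint_family_on_iff_unique_index by blast
  then show ?thesis
    using assms(1,3) by (simp add: disjoint_colourings_def Pi_iff)
qed

lemma ex_disjoint_colourings_bij_betw:
  assumes "bij_betw h U V"
  shows "(\<exists>f. disjoint_colourings U C J f) \<longleftrightarrow> (\<exists>f. disjoint_colourings V C J f)"
proof -
  obtain g where "bij_betw g V U"
    using bij_betw_inv[OF assms] by blast
  then have "inj_on h U" "h \<in> U \<rightarrow> V" "inj_on g V" "g \<in> V \<rightarrow> U"
    using assms by (auto simp: bij_betw_def)
  then show ?thesis
    using disjoint_colourings_comp[where h = h] disjoint_colourings_comp[where h = g] by blast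
qed

lemma id_problem_le_PHP_iff_colourings_lessThan:
  "id_problem k \<le>\<^sub>P PHP m n \<longleftrightarrow> (\<exists>f. disjoint_colourings {..<m} {..<n} {1..k} f)"
proof -
  let ?disjoint = "\<lambda>\<Phi>. disjoint_family_on (\<lambda>j. monochromatic_pairs {..<m} (\<Phi> j)) {1..k}"
  have "solutions (PHP m n) = monochromatic_pairs {..<m}" "instances (PHP m n) = {..<m} \<rightarrow>\<^sub>E {..<n}"
    by (auto simp: PHP_def monochromatic_pairs_def fun_eq_iff)
  then have "id_problem k \<le>\<^sub>P PHP m n \<longleftrightarrow> (\<exists>\<Phi>. \<Phi> ` {1..k} \<subseteq> {..<m} \<rightarrow>\<^sub>E {..<n} \<and> ?disjoint \<Phi>)"
    by (simp add: id_problem_le_iff)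
  also have "\<dots> \<longleftrightarrow> (\<exists>f. disjoint_colourings {..<m} {..<n} {1..k} f)"
  proof
    assume "\<exists>f. disjoint_colourings {..<m} {..<n} {1..k} f"
    then obtain f where "disjoint_colourings {..<m} {..<n} {1..k} f" ..
    then show "\<exists>\<Phi>. \<Phi> ` {1..k} \<subseteq> {..<m} \<rightarrow>\<^sub>E {..<n} \<and> ?disjoint \<Phi>"
      by (intro exI[of _ "\<lambda>j. restrict (f j) {..<m}"])
        (simp add: disjoint_colourings_def monochromatic_pairs_restrict image_subset_iff Pi_iff)
  qed (auto simp: disjoint_colourings_def PiE_def)
  finally show ?thesis .
qed

lemma id_problem_le_PHP_iff:
  assumes "finite V" and "card V = m"
  shows "id_problem k \<le>\<^sub>P PHP m n \<longleftrightarrow> (\<exists>f. disjoint_colourings V {..<n} {1..k} f)"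
proof -
  obtain h where "bij_betw h {..<m} V"
    using finite_same_card_bij[of "{..<m}" V] assms by auto
  then show ?thesis
    by (simp add: id_problem_le_PHP_iff_colourings_lessThan ex_disjoint_colourings_bij_betw)
qed

section \<open>Counting monochromatic pairs\<close>

lemma card_eq_sum_card_colour_classes:
  assumes "finite V" and "finite C" and "f \<in> V \<rightarrow> C"
  shows "card V = (\<Sum>c\<in>C. card {a \<in> V. f a = c})"
  using sum.group[of V C f "\<lambda>_. 1 :: nat"] assms by (simp add: image_subset_iff_funcset)

lemma double_choose_two: "2 * int (n choose 2) = int n * (int n - 1)"
proof -
  have "2 * (n choose 2) = n * (n - 1)"
    using times_binomial_minus1_eq[of 2 n] by simp
  then have "int (2 * (n choose 2)) = int (n * (n - 1))"
    by (rule arg_cong)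
  then show ?thesis
    by (cases n) (simp_all add: algebra_simps)
qed

lemma card_monochromatic_pairs:
  assumes "finite V" and "finite C" and "f \<in> V \<rightarrow> C"
  shows "card (monochromatic_pairs V f) = (\<Sum>c\<in>C. card {a \<in> V. f a = c} choose 2)"
proof -
  have "monochromatic_pairs V f = (\<Union>c\<in>C. [{a \<in> V. f a = c}]\<^bsup>2\<^esup>)"
    using assms(3) by (auto simp: monochromatic_pairs_def nsets_2_eq)
  moreover have "[{a \<in> V. f a = c}]\<^bsup>2\<^esup> \<inter> [{a \<in> V. f a = d}]\<^bsup>2\<^esup> = {}" if "c \<noteq> d" for c d
    using that by (auto simp: nsets_2_eq doubleton_eq_iff)
  ultimately show ?thesis
    using assms by (simp add: card_UN_disjoint finite_imp_finite_nsets)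
qed

lemma double_card_monochromatic_pairs:
  assumes "finite V" and "finite C" and "f \<in> V \<rightarrow> C" and "card V = q * card C"
  shows "2 * int (card (monochromatic_pairs V f)) =
           int (card V) * (int q - 1) + (\<Sum>c\<in>C. (int (card {a \<in> V. f a = c}) - int q)\<^sup>2)"
proof -
  define s where "s c = int (card {a \<in> V. f a = c})" for c
  have sum_s: "(\<Sum>c\<in>C. s c) = int q * int (card C)"
    using card_eq_sum_card_colour_classes[OF assms(1-3)] assms(4)
    by (simp add: s_def flip: of_nat_sum of_nat_mult)
  have "2 * int (card (monochromatic_pairs V f)) = (\<Sum>c\<in>C. s c * (s c - 1))"
    by (simp add: card_monochromatic_pairs[OF assms(1-3)] sum_distrib_left double_choose_two s_def)
  also have "\<dots> = (\<Sum>c\<in>C. (2 * int q - 1) * s c - (int q)\<^sup>2 + (s c - int q)\<^sup>2)"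
    by (intro sum.cong refl) (simp add: power2_eq_square algebra_simps)
  also have "\<dots> = (2 * int q - 1) * (\<Sum>c\<in>C. s c) - int (card C) * (int q)\<^sup>2 +
      (\<Sum>c\<in>C. (s c - int q)\<^sup>2)"
    by (simp add: sum.distrib sum_subtractf sum_distrib_left)
  also have "\<dots> = int (card V) * (int q - 1) + (\<Sum>c\<in>C. (s c - int q)\<^sup>2)"
    by (simp add: sum_s assms(4) power2_eq_square algebra_simps)
  finally show ?thesis
    by (simp add: s_def)
qed

section \<open>Resolving families of colourings\<close>

definition resolving_colourings ::
    "'a set \<Rightarrow> 'c set \<Rightarrow> 'j set \<Rightarrow> nat \<Rightarrow> nat \<Rightarrow> ('j \<Rightarrow> 'a \<Rightarrow> 'c) \<Rightarrow> bool" where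
  "resolving_colourings V C J q l f \<longleftrightarrow>
     (\<forall>j\<in>J. f j \<in> V \<rightarrow> C \<and> (\<forall>c\<in>C. card {a \<in> V. f j a = c} = q)) \<and>
     (\<forall>a\<in>V. \<forall>b\<in>V. a \<noteq> b \<longrightarrow> card {j \<in> J. f j a = f j b} = l)"

lemma resolving_colourings_card_index:
  assumes "finite V" and "V \<noteq> {}" and "finite C" and "finite J" and card_V: "card V = q * card C"
    and res: "resolving_colourings V C J q l f"
  shows "int (card J) * (int q - 1) = int l * (int (card V) - 1)"
proof -
  let ?M = "\<lambda>j. monochromatic_pairs V (f j)"
  have pairs: "2 * int (card (?M j)) = int (card V) * (int q - 1)" if "j \<in> J" for j
    using double_card_monochromatic_pairs[OF assms(1,3) _ card_V, of "f j"] res that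
    by (simp add: resolving_colourings_def)
  have "{e \<in> [V]\<^bsup>2\<^esup>. e \<in> ?M j} = ?M j" for j
    using monochromatic_pairs_subset_nsets by blast
  then have "(\<Sum>j\<in>J. card (?M j)) = (\<Sum>j\<in>J. card {e \<in> [V]\<^bsup>2\<^esup>. e \<in> ?M j})"
    by simp
  also have "\<dots> = l * card ([V]\<^bsup>2\<^esup>)"
    using assms(1,4) res
    by (intro sum_multicount)
      (auto simp: finite_imp_finite_nsets resolving_colourings_def elim!: nsets2_E)
  finally have "int l * (2 * int (card ([V]\<^bsup>2\<^esup>))) = (\<Sum>j\<in>J. 2 * int (card (?M j)))"
    by (simp flip: sum_distrib_left of_nat_sum)
  also have "\<dots> = int (card V) * (int (card J) * (int q - 1))"
    by (simp add: pairs)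
  finally have "int (card V) * (int l * (int (card V) - 1)) =
      int (card V) * (int (card J) * (int q - 1))"
    by (simp add: double_choose_two mult.left_commute)
  then show ?thesis
    using assms(1,2) by simp
qed

lemma resolving_imp_disjoint_colourings:
  assumes "resolving_colourings V C J q 1 f"
  shows "disjoint_colourings V C J f"
  unfolding disjoint_colourings_def disjoint_family_on_iff_card_index
proof (intro conjI ballI)
  show "f j \<in> V \<rightarrow> C" if "j \<in> J" for j
    using assms that by (simp add: resolving_colourings_def)
next
  fix e
  assume "e \<in> (\<Union>j\<in>J. monochromatic_pairs V (f j))"
  then obtain a b where "e = {a, b}" "a \<in> V" "b \<in> V" "a \<noteq> b"
    by (auto simp: monochromatic_pairs_def)
  then show "card {j \<in> J. e \<in> monochromatic_pairs V (f j)} = 1"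
    using assms by (simp add: resolving_colourings_def)
qed

lemma double_card_Union_monochromatic_pairs:
  assumes fin: "finite V" "finite C" "finite J"
    and card_V: "card V = q * card C"
    and f: "disjoint_colourings V C J f"
  shows "2 * int (card (\<Union>j\<in>J. monochromatic_pairs V (f j))) =
           int (card V) * (int (card J) * (int q - 1)) +
           (\<Sum>j\<in>J. \<Sum>c\<in>C. (int (card {a \<in> V. f j a = c}) - int q)\<^sup>2)"
proof -
  let ?M = "\<lambda>j. monochromatic_pairs V (f j)"
  have "finite (?M j)" for j
    using monochromatic_pairs_subset_nsets finite_imp_finite_nsets[OF fin(1)] by (rule finite_subset)
  then have "card (\<Union>j\<in>J. ?M j) = (\<Sum>j\<in>J. card (?M j))"
    using f fin(3) by (simp add: card_UN_disjoint disjoint_colourings_def disjoint_family_on_def)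
  then have "2 * int (card (\<Union>j\<in>J. ?M j)) = (\<Sum>j\<in>J. 2 * int (card (?M j)))"
    by (simp add: sum_distrib_left)
  also have "\<dots> = (\<Sum>j\<in>J. int (card V) * (int q - 1) +
      (\<Sum>c\<in>C. (int (card {a \<in> V. f j a = c}) - int q)\<^sup>2))"
    using f by (intro sum.cong refl double_card_monochromatic_pairs fin card_V)
      (simp add: disjoint_colourings_def)
  finally show ?thesis
    by (simp add: sum.distrib)
qed

lemma disjoint_imp_resolving_colourings:
  assumes fin: "finite V" "finite C" "finite J"
    and card_V: "card V = q * card C"
    and card_J: "int (card J) * (int q - 1) = int (card V) - 1"
    and f: "disjoint_colourings V C J f"
  shows "resolving_colourings V C J q 1 f"
proof -
  let ?M = "\<lambda>j. monochromatic_pairs V (f j)"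
  define excess where "excess j = (\<Sum>c\<in>C. (int (card {a \<in> V. f j a = c}) - int q)\<^sup>2)" for j
  have excess_nonneg: "excess j \<ge> 0" for j
    by (simp add: excess_def sum_nonneg)
  have fin_pairs: "finite ([V]\<^bsup>2\<^esup>)" and M_subset: "(\<Union>j\<in>J. ?M j) \<subseteq> [V]\<^bsup>2\<^esup>"
    using fin(1) monochromatic_pairs_subset_nsets by (auto simp: finite_imp_finite_nsets)
  have count: "2 * int (card (\<Union>j\<in>J. ?M j)) = 2 * int (card ([V]\<^bsup>2\<^esup>)) + (\<Sum>j\<in>J. excess j)"
    using double_card_Union_monochromatic_pairs[OF fin card_V f]
    by (simp add: card_J double_choose_two excess_def)
  moreover have "card (\<Union>j\<in>J. ?M j) \<le> card ([V]\<^bsup>2\<^esup>)"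
    by (rule card_mono[OF fin_pairs M_subset])
  ultimately have sum_excess: "(\<Sum>j\<in>J. excess j) = 0"
    using sum_nonneg[of J excess] excess_nonneg by simp
  then have "excess j = 0" if "j \<in> J" for j
    using that fin(3) excess_nonneg by (simp add: sum_nonneg_eq_0_iff)
  then have uniform: "\<forall>j\<in>J. \<forall>c\<in>C. card {a \<in> V. f j a = c} = q"
    using fin(2) by (simp add: excess_def sum_nonneg_eq_0_iff)
  have "(\<Union>j\<in>J. ?M j) = [V]\<^bsup>2\<^esup>"
    using count sum_excess by (intro card_subset_eq fin_pairs M_subset) simp
  then have "\<forall>e\<in>[V]\<^bsup>2\<^esup>. card {j \<in> J. e \<in> ?M j} = 1"
    using f by (simp add: disjoint_colourings_def disjoint_family_on_iff_card_index)
  then have "card {j \<in> J. f j a = f j b} = 1" if "a \<in> V" "b \<in> V" "a \<noteq> b" for a b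
    using that by (force dest: bspec[of _ _ "{a, b}"])
  then show ?thesis
    using f uniform by (simp add: disjoint_colourings_def resolving_colourings_def)
qed

section \<open>Colour classes as blocks\<close>

definition colour_classes :: "'a set \<Rightarrow> 'c set \<Rightarrow> ('a \<Rightarrow> 'c) \<Rightarrow> 'a set multiset" where
  "colour_classes V C f = image_mset (\<lambda>c. {a \<in> V. f a = c}) (mset_set C)"

lemma size_filter_colour_classes:
  "finite C \<Longrightarrow> size (filter_mset P (colour_classes V C f)) = card {c \<in> C. P {a \<in> V. f a = c}}"
  by (simp add: colour_classes_def filter_mset_image_mset)

lemma parallel_class_colour_classes:
  assumes "finite C" and "f \<in> V \<rightarrow> C"
  shows "parallel_class V (colour_classes V C f)"
  unfolding parallel_class_def
proof
  fix x assume "x \<in> V"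
  then have "{c \<in> C. x \<in> {a \<in> V. f a = c}} = {f x}"
    using assms(2) by auto
  then show "size {#b \<in># colour_classes V C f. x \<in> b#} = 1"
    by (simp add: size_filter_colour_classes[OF assms(1)])
qed

lemma size_filter_mset_sum:
  "size (filter_mset P (\<Sum>j\<in>J. M j)) = (\<Sum>j\<in>J. size (filter_mset P (M j)))"
  by (induction J rule: infinite_finite_induct) auto

lemma BIBD_colour_classes_iff:
  assumes "finite C" and "finite J" and "\<forall>j\<in>J. f j \<in> V \<rightarrow> C"
  shows "BIBD V (\<Sum>j\<in>J. colour_classes V C (f j)) p q l \<longleftrightarrow>
           finite V \<and> card V = p \<and> resolving_colourings V C J q l f"
proof -
  let ?B = "\<Sum>j\<in>J. colour_classes V C (f j)"
  have "size {#b \<in># ?B. x \<in> b \<and> y \<in> b#} = card {j \<in> J. f j x = f j y}"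
    if "x \<in> V" "y \<in> V" for x y
  proof -
    have "{c \<in> C. x \<in> {a \<in> V. f j a = c} \<and> y \<in> {a \<in> V. f j a = c}} =
        (if f j x = f j y then {f j x} else {})" if "j \<in> J" for j
      using assms(3) \<open>x \<in> V\<close> \<open>y \<in> V\<close> that by auto
    then have "size {#b \<in># colour_classes V C (f j). x \<in> b \<and> y \<in> b#} =
        (if f j x = f j y then 1 else 0)" if "j \<in> J" for j
      using that by (simp add: size_filter_colour_classes[OF assms(1)])
    then have "size {#b \<in># ?B. x \<in> b \<and> y \<in> b#} = (\<Sum>j\<in>J. if f j x = f j y then 1 else 0)"
      by (simp add: size_filter_mset_sum)
    then show ?thesis
      using assms(2) by (simp flip: sum.inter_filter)
  qed
  moreover have "(\<forall>b\<in>#?B. b \<subseteq> V \<and> card b = q) \<longleftrightarrow> (\<forall>j\<in>J. \<forall>c\<in>C. card {a \<in> V. f j a = c} = q)"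
    using assms(1,2) by (auto simp: colour_classes_def set_mset_sum)
  ultimately show ?thesis
    using assms(3) by (auto simp: BIBD_def resolving_colourings_def)
qed

lemma RBIBD_of_resolving_colourings:
  assumes "finite V" and "finite C" and "finite J" and "resolving_colourings V C J q l f"
  shows "RBIBD V (\<Sum>j\<in>J. colour_classes V C (f j)) (card V) q l"
proof -
  have maps: "\<forall>j\<in>J. f j \<in> V \<rightarrow> C"
    using assms(4) by (simp add: resolving_colourings_def)
  then have "BIBD V (\<Sum>j\<in>J. colour_classes V C (f j)) (card V) q l"
    using assms by (simp add: BIBD_colour_classes_iff)
  moreover have "\<forall>M\<in>#{#colour_classes V C (f j). j \<in># mset_set J#}. parallel_class V M"
    using assms(2,3) maps by (auto intro: parallel_class_colour_classes)
  ultimately show ?thesis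
    unfolding RBIBD_def sum_unfold_sum_mset by blast
qed

lemma ex_image_mset_mset_set:
  assumes "finite I" and "card I = size M"
  shows "\<exists>g. M = image_mset g (mset_set I)"
proof -
  obtain xs where xs: "mset xs = M"
    using ex_mset by blast
  obtain h where "bij_betw h I {..<length xs}"
    using ex_bij_betw_finite_nat[OF assms(1)] assms(2) xs by (auto simp: atLeast0LessThan)
  then have "image_mset h (mset_set I) = mset_set {..<length xs}"
    by (simp add: image_mset_mset_set bij_betw_def)
  then have "image_mset (nth xs \<circ> h) (mset_set I) = mset (map (nth xs) [0..<length xs])"
    by (simp add: atLeast0LessThan flip: multiset.map_comp)
  then show ?thesis
    using xs by (metis map_nth)
qed

lemma parallel_class_eq_colour_classes:
  assumes "parallel_class V M" and "\<forall>b\<in>#M. b \<subseteq> V" and "finite C" and "card C = size M"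
  shows "\<exists>f\<in>V \<rightarrow> C. M = colour_classes V C f"
proof -
  obtain g where M: "M = image_mset g (mset_set C)"
    using ex_image_mset_mset_set[OF assms(3,4)] by blast
  have "\<exists>c. \<forall>d. d \<in> C \<and> x \<in> g d \<longleftrightarrow> d = c" if "x \<in> V" for x
    using assms(1,3) that
    by (simp add: parallel_class_def M filter_mset_image_mset card_1_singleton_iff set_eq_iff)
  then obtain f where f: "\<And>x c. x \<in> V \<Longrightarrow> c \<in> C \<and> x \<in> g c \<longleftrightarrow> f x = c"
    by metis
  have "g c = {a \<in> V. f a = c}" if "c \<in> C" for c
  proof -
    have "g c \<subseteq> V"
      using assms(2,3) that by (simp add: M)
    then show ?thesis
      using f that by blast
  qed
  then have "M = colour_classes V C f"
    unfolding M colour_classes_def using assms(3) by (intro image_mset_cong) simp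
  moreover have "f \<in> V \<rightarrow> C"
    using f by blast
  ultimately show ?thesis
    by blast
qed

lemma card_points_parallel_class:
  assumes "finite V" and "parallel_class V M" and "\<forall>b\<in>#M. b \<subseteq> V \<and> card b = q"
  shows "card V = q * size M"
proof -
  obtain f where f: "f \<in> V \<rightarrow> {..<size M}" and M: "M = colour_classes V {..<size M} f"
    using parallel_class_eq_colour_classes[OF assms(2), of "{..<size M}"] assms(3) by auto
  have "\<forall>c\<in>{..<size M}. card {a \<in> V. f a = c} = q"
    using assms(3) by (subst (asm) (1) M) (auto simp: colour_classes_def)
  then show ?thesis
    using card_eq_sum_card_colour_classes[OF assms(1) _ f] by simp
qed

lemma RBIBD_imp_resolving_colourings:
  assumes "RBIBD V \<B> (q * card C) q l" and "q > 0" and "finite C"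
  shows "\<exists>k f. resolving_colourings V C {1..k :: nat} q l f"
proof -
  obtain R where bibd: "BIBD V (\<Sum>\<^sub># R) (q * card C) q l" and par: "\<forall>M\<in>#R. parallel_class V M"
    using assms(1) by (auto simp: RBIBD_def)
  obtain g where R: "R = image_mset g (mset_set {1..size R})"
    using ex_image_mset_mset_set[of "{1..size R}" R] by auto
  have "\<exists>f\<in>V \<rightarrow> C. M = colour_classes V C f" if "M \<in># R" for M
  proof -
    have blocks: "\<forall>b\<in>#M. b \<subseteq> V \<and> card b = q" and V: "finite V" "card V = q * card C"
      using bibd that by (auto simp: BIBD_def)
    then have "card C = size M"
      using card_points_parallel_class[OF V(1) _ blocks] par that assms(2) by simp
    then show ?thesis
      using parallel_class_eq_colour_classes assms(3) par blocks that by blast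
  qed
  then have "\<forall>j\<in>{1..size R}. \<exists>f\<in>V \<rightarrow> C. g j = colour_classes V C f"
    by (subst (asm) R) simp
  then obtain f where f: "\<forall>j\<in>{1..size R}. f j \<in> V \<rightarrow> C"
    and g: "\<forall>j\<in>{1..size R}. g j = colour_classes V C (f j)"
    by metis
  have "\<Sum>\<^sub># R = (\<Sum>j\<in>{1..size R}. g j)"
    by (subst R) (simp add: sum_unfold_sum_mset)
  also have "\<dots> = (\<Sum>j\<in>{1..size R}. colour_classes V C (f j))"
    using g by simp
  finally have "\<Sum>\<^sub># R = (\<Sum>j\<in>{1..size R}. colour_classes V C (f j))" .
  then show ?thesis
    using bibd f by (auto simp: BIBD_colour_classes_iff assms(3))
qed

lemma RBIBD_iff_disjoint_colourings:
  fixes V :: "'a set" and C :: "'b set"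
  assumes "finite V" and "V \<noteq> {}" and "finite C" and card_V: "card V = q * card C" and "q \<ge> 2"
    and k: "int k * (int q - 1) = int (card V) - 1"
  shows "(\<exists>\<B>. RBIBD V \<B> (card V) q 1) \<longleftrightarrow> (\<exists>f. disjoint_colourings V C {1..k} f)"
proof
  assume "\<exists>\<B>. RBIBD V \<B> (card V) q 1"
  then obtain \<B> where "RBIBD V \<B> (q * card C) q 1"
    using card_V by auto
  then obtain m and f :: "nat \<Rightarrow> 'a \<Rightarrow> 'b" where f: "resolving_colourings V C {1..m} q 1 f"
    using RBIBD_imp_resolving_colourings[of V \<B> q C 1] assms(3,5) by auto
  then have "int m * (int q - 1) = int k * (int q - 1)"
    using resolving_colourings_card_index[OF assms(1-3) _ card_V f] k by simp
  then have "m = k"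
    using assms(5) by simp
  then show "\<exists>f. disjoint_colourings V C {1..k} f"
    using resolving_imp_disjoint_colourings[OF f] by blast
next
  assume "\<exists>f. disjoint_colourings V C {1..k} f"
  then obtain f where "disjoint_colourings V C {1..k} f" ..
  then have "resolving_colourings V C {1..k} q 1 f"
    using assms(1,3) card_V k by (intro disjoint_imp_resolving_colourings) simp_all
  then show "\<exists>\<B>. RBIBD V \<B> (card V) q 1"
    using RBIBD_of_resolving_colourings[OF assms(1,3)] by blast
qed

theorem theorem2p15:
  fixes q n :: nat
  assumes "q \<ge> 2" and "n \<ge> 2" and "(q - 1) dvd (q * n - 1)"
  shows "id_problem ((q * n - 1) div (q - 1)) \<le>\<^sub>P PHP (q * n) n \<longleftrightarrow>
         (\<exists>(V :: nat set) \<B>. RBIBD V \<B> (q * n) q 1)"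
proof -
  define k where "k = (q * n - 1) div (q - 1)"
  have "q * n > 0"
    using assms(1,2) by simp
  have "int (k * (q - 1)) = int (q * n - 1)"
    using assms(3) by (simp add: k_def)
  then have k: "int k * (int q - 1) = int (q * n) - 1"
    using assms(1) \<open>q * n > 0\<close> by (simp add: Suc_le_eq)
  have le_PHP_iff: "id_problem k \<le>\<^sub>P PHP (q * n) n \<longleftrightarrow> (\<exists>\<B>. RBIBD V \<B> (q * n) q 1)"
    if V: "finite V" "card V = q * n" for V :: "nat set"
  proof -
    have "V \<noteq> {}"
      using V \<open>q * n > 0\<close> by auto
    then show ?thesis
      using RBIBD_iff_disjoint_colourings[of V "{..<n}" q k] V assms(1) k
      by (simp add: id_problem_le_PHP_iff[OF V])
  qed
  have "finite V \<and> card V = q * n" if "RBIBD V \<B> (q * n) q 1" for V :: "nat set" and \<B>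
    using that by (simp add: RBIBD_def BIBD_def)
  then show ?thesis
    unfolding k_def[symmetric] using le_PHP_iff by (metis card_lessThan finite_lessThan)
qed

end
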